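(* Let $X=\mathbb{N}$ and let $G$ be a group of computable permutations of $X$ such that the $G$-space $(G,X)$ does not satisfy F\o lner's condition. Then there exist a finite subset $K\subset G$ and two families $(A_k)_{k\in K}$, $(B_k)_{k\in K}$ of computable subsets of $X$ such that $$X=\Big(\bigsqcup_{k\in K}k(A_k)\Big)\sqcup\Big(\bigsqcup_{k\in K}k(B_k)\Big)=\bigsqcup_{k\in K}A_k=\bigsqcup_{k\in K}B_k,$$ i.e. $(K,(A_k)_{k\in K},(B_k)_{k\in K})$ is a computable paradoxical decomposition of $X$.
   Context: $\bigsqcup$ denotes a union of pairwise disjoint sets; some of the sets $A_k$, $B_k$ may be empty. For $k\in G$ and $A\subseteq X$, $k(A)$ is the image of $A$ under $k$. $G$ is a group under composition, each of whose elements is a computable permutation of $\mathbb{N}$. For $R\subseteq G$ and $A\subseteq X$ put $$\partial_R A=\{x\in X\setminus A:\ \exists\rho\in R\cup R^{-1}\ (\rho(x)\in A)\}.$$ The $G$-space $(G,X)$ satisfies F\o lner's condition if for every finite $R\subseteq G$ and every natural number $n\ge1$ there is a finite non-empty $F\subseteq X$ with $|\partial_R F|<\frac1n|F|$. *)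

theory Defs
  imports Complex_Main "HOL-Algebra.Bij" "HOL-Library.Disjoint_Sets"
begin

text \<open>
  The partial recursive functions, given by terms with an evaluation relation: \<open>evaluates p xs y\<close>
  says that the function described by \<open>p\<close> is defined on the argument tuple \<open>xs\<close>, with value \<open>y\<close>.
  Terms carry no arity; one term may describe a partial function of every arity.
  On a tuple whose length does not fit the term, evaluation is undefined.
\<close>

datatype recf =
    Zero
  | Succ
  | Proj nat
  | Comp recf "recf list"
  | PrimRec recf recf
  | Mu recf

inductive evaluates :: "recf \<Rightarrow> nat list \<Rightarrow> nat \<Rightarrow> bool" where
  zero: "evaluates Zero xs 0"
| succ: "evaluates Succ [x] (Suc x)"
| proj: "i < length xs \<Longrightarrow> evaluates (Proj i) xs (xs ! i)"
| comp: "list_all2 (\<lambda>g y. evaluates g xs y) gs ys \<Longrightarrow> evaluates f ys z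
    \<Longrightarrow> evaluates (Comp f gs) xs z"
| primrec_0: "evaluates f xs y \<Longrightarrow> evaluates (PrimRec f g) (0 # xs) y"
| primrec_Suc: "evaluates (PrimRec f g) (n # xs) y \<Longrightarrow> evaluates g (n # y # xs) z
    \<Longrightarrow> evaluates (PrimRec f g) (Suc n # xs) z"
| mu: "evaluates f (n # xs) 0 \<Longrightarrow> \<forall>m<n. \<exists>y. evaluates f (m # xs) (Suc y)
    \<Longrightarrow> evaluates (Mu f) xs n"
monos list.rel_mono_strong

lemma evaluates_deterministic:
  "evaluates p xs y \<Longrightarrow> evaluates p xs z \<Longrightarrow> y = z"
proof (induction p xs y arbitrary: z rule: evaluates.induct)
  case (comp xs gs ys f y)
  from comp.prems obtain ys' where ys': "list_all2 (\<lambda>g y. evaluates g xs y) gs ys'"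
    "evaluates f ys' z"
    by (cases rule: evaluates.cases) auto
  have "ys = ys'"
    using comp.IH(1) ys'(1) by (auto simp: list_all2_conv_all_nth intro!: nth_equalityI)
  then show ?case
    using comp.IH(2) ys'(2) by blast
next
  case (mu f n xs)
  from mu.prems have z: "evaluates f (z # xs) 0" "\<forall>m<z. \<exists>y. evaluates f (m # xs) (Suc y)"
    by (cases rule: evaluates.cases; simp)+
  show ?case
  proof (rule linorder_cases[of n z])
    assume "n < z"
    then show ?thesis using z(2) mu.IH by blast
  next
    assume "z < n"
    then show ?thesis using z(1) mu.IH by blast
  qed
next
  case (primrec_0 f xs y g)
  from primrec_0.prems show ?case
    by (cases rule: evaluates.cases) (simp_all add: primrec_0.IH)
next
  case (primrec_Suc f g n xs y w)
  from primrec_Suc.prems obtain y' where "evaluates (PrimRec f g) (n # xs) y'"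
    "evaluates g (n # y' # xs) z"
    by (cases rule: evaluates.cases) auto
  then show ?case
    using primrec_Suc.IH by blast
qed (erule evaluates.cases; simp)+

definition computable_fun :: "(nat \<Rightarrow> nat) \<Rightarrow> bool" where
  "computable_fun f \<longleftrightarrow> (\<exists>p. \<forall>x. evaluates p [x] (f x))"

definition computable_set :: "nat set \<Rightarrow> bool" where
  "computable_set A \<longleftrightarrow> computable_fun (\<lambda>x. if x \<in> A then 1 else 0)"

text \<open>
  A permutation group of \<open>X\<close> is a subgroup of \<open>BijGroup X\<close>. In the following, \<open>X\<close> is the whole
  type, where the extensionality built into \<^const>\<open>BijGroup\<close> is void. The inverse is written
  \<open>inv_into UNIV\<close>, as \<open>inv\<close> is taken by the group theory.
\<close>

lemma subgroup_BijGroup_UNIV_iff: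
  "subgroup G (BijGroup UNIV) \<longleftrightarrow>
    (\<forall>g\<in>G. bij g) \<and> id \<in> G \<and> (\<forall>g\<in>G. \<forall>h\<in>G. g \<circ> h \<in> G) \<and> (\<forall>g\<in>G. inv_into UNIV g \<in> G)"
  (is "_ \<longleftrightarrow> ?bij \<and> ?id \<and> ?comp \<and> ?inv")
proof -
  have carrier: "carrier (BijGroup UNIV) = {g :: 'a \<Rightarrow> 'a. bij g}"
    by (simp add: BijGroup_def Bij_def)
  have one: "\<one>\<^bsub>BijGroup UNIV\<^esub> = (id :: 'a \<Rightarrow> 'a)"
    by (simp add: BijGroup_def id_def restrict_def)
  have mult: "g \<otimes>\<^bsub>BijGroup UNIV\<^esub> h = g \<circ> h" if "bij g" "bij h" for g h :: "'a \<Rightarrow> 'a"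
    using that by (simp add: BijGroup_def Bij_def compose_def fun_eq_iff)
  have inv: "inv\<^bsub>BijGroup UNIV\<^esub> g = inv_into UNIV g" if "bij g" for g :: "'a \<Rightarrow> 'a"
    using that by (simp add: inv_BijGroup Bij_def restrict_def)
  show ?thesis
    unfolding subgroup_def carrier one using mult inv by (auto simp: subset_iff)
qed

definition boundary :: "('a \<Rightarrow> 'a) set \<Rightarrow> 'a set \<Rightarrow> 'a set" where
  "boundary R A = {x \<in> UNIV - A. \<exists>\<rho> \<in> R \<union> inv_into UNIV ` R. \<rho> x \<in> A}"

definition folner_condition :: "('a \<Rightarrow> 'a) set \<Rightarrow> bool" where
  "folner_condition G \<longleftrightarrow>
    (\<forall>R n. R \<subseteq> G \<and> finite R \<and> n \<ge> 1 \<longrightarrow>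
      (\<exists>F. finite F \<and> F \<noteq> {} \<and> real (card (boundary R F)) < 1 / real n * real (card F)))"

definition paradoxical_decomposition ::
    "('a \<Rightarrow> 'a) set \<Rightarrow> (('a \<Rightarrow> 'a) \<Rightarrow> 'a set) \<Rightarrow> (('a \<Rightarrow> 'a) \<Rightarrow> 'a set) \<Rightarrow> bool" where
  "paradoxical_decomposition K A B \<longleftrightarrow>
    disjoint_family_on (\<lambda>k. k ` A k) K \<and> disjoint_family_on (\<lambda>k. k ` B k) K \<and>
    (\<Union>k\<in>K. k ` A k) \<inter> (\<Union>k\<in>K. k ` B k) = {} \<and>
    UNIV = (\<Union>k\<in>K. k ` A k) \<union> (\<Union>k\<in>K. k ` B k) \<and>
    disjoint_family_on A K \<and> UNIV = (\<Union>k\<in>K. A k) \<and>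
    disjoint_family_on B K \<and> UNIV = (\<Union>k\<in>K. B k)"

definition computable_paradoxical_decomposition ::
    "(nat \<Rightarrow> nat) set \<Rightarrow> ((nat \<Rightarrow> nat) \<Rightarrow> nat set) \<Rightarrow> ((nat \<Rightarrow> nat) \<Rightarrow> nat set) \<Rightarrow> bool" where
  "computable_paradoxical_decomposition K A B \<longleftrightarrow>
    finite K \<and> (\<forall>k\<in>K. computable_set (A k) \<and> computable_set (B k)) \<and>
    paradoxical_decomposition K A B"

end

theory Submission
  imports Defs "HOL-Library.Nat_Bijection"
begin

text \<open>
  If Folner's condition fails, then some finite symmetric \<open>K \<subseteq> G\<close> satisfies
  \<open>4 |F| \<le> |K F|\<close> for all finite \<open>F\<close>. Join each of two copies of \<open>x\<close> to the points of \<open>K x\<close>; a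
  computable perfect matching of this bipartite graph yields the decomposition.

  The matching is built in finite stages, each of which must be extendable to arbitrary finite sets
  of vertices. This is semidecidable by the expansion: removing the vertices of a finite matching
  with at most \<open>m\<close> edges can destroy Hall's condition only for sets with fewer than \<open>m\<close> elements, and
  hence only within a ball of computable radius around these vertices, so a finite matching that
  extends the given one and covers this ball certifies extendability. Extendability is preserved by some
  choice of partners for the next vertices, so an unbounded search for it together with a
  certificate always succeeds.
\<close>

section \<open>Computable functions\<close>

lemma evaluates_comp1:
  "evaluates g xs y \<Longrightarrow> evaluates f [y] z \<Longrightarrow> evaluates (Comp f [g]) xs z"
  by (rule evaluates.comp[of _ _ "[y]"]) auto

lemma evaluates_comp2:
  "evaluates g xs y \<Longrightarrow> evaluates h xs z \<Longrightarrow> evaluates f [y, z] w \<Longrightarrow> evaluates (Comp f [g, h]) xs w"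
  by (rule evaluates.comp[of _ _ "[y, z]"]) auto

lemma evaluates_proj: "i < length xs \<Longrightarrow> y = xs ! i \<Longrightarrow> evaluates (Proj i) xs y"
  using evaluates.proj by simp

lemma evaluates_primrec:
  assumes "evaluates p xs a" and "\<And>n y. evaluates q (n # y # xs) (h n y)"
  shows "evaluates (PrimRec p q) (n # xs) (rec_nat a h n)"
  by (induction n) (auto intro: evaluates.primrec_0 evaluates.primrec_Suc assms)

lemma evaluates_mu:
  assumes "\<And>n. evaluates p (n # xs) (h n)" and "h k = 0"
  shows "evaluates (Mu p) xs (LEAST n. h n = 0)"
proof (rule evaluates.mu)
  show "evaluates p ((LEAST n. h n = 0) # xs) 0"
    using assms(1)[of "LEAST n. h n = 0"] LeastI[of "\<lambda>n. h n = 0", OF assms(2)] by simp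
  show "\<forall>m<LEAST n. h n = 0. \<exists>y. evaluates p (m # xs) (Suc y)"
    using assms(1) not_less_Least[of _ "\<lambda>n. h n = 0"] by (metis not0_implies_Suc)
qed

text \<open>\<open>PrimRec\<close> and \<open>Mu\<close> prepend arguments to the tuple, so even
  unary functions built with them need terms for binary ones. Once pairing is available,
  \<open>computable_fun2I\<close> reduces these to unary functions of a coded pair.\<close>

definition computable_fun2 :: "(nat \<Rightarrow> nat \<Rightarrow> nat) \<Rightarrow> bool" where
  "computable_fun2 f \<longleftrightarrow> (\<exists>p. \<forall>x y. evaluates p [x, y] (f x y))"

lemma computable_fun_comp:
  assumes "computable_fun f" and "computable_fun g"
  shows "computable_fun (\<lambda>x. f (g x))"
  using assms unfolding computable_fun_def by (meson evaluates_comp1)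

lemma computable_fun_comp2:
  assumes "computable_fun2 f" and "computable_fun g" and "computable_fun h"
  shows "computable_fun (\<lambda>x. f (g x) (h x))"
  using assms unfolding computable_fun_def computable_fun2_def by (meson evaluates_comp2)

lemma computable_fun2_comp:
  assumes "computable_fun f" and "computable_fun2 g"
  shows "computable_fun2 (\<lambda>x y. f (g x y))"
  using assms unfolding computable_fun_def computable_fun2_def by (meson evaluates_comp1)

lemma computable_fun2_comp2:
  assumes "computable_fun2 f" and "computable_fun2 g" and "computable_fun2 h"
  shows "computable_fun2 (\<lambda>x y. f (g x y) (h x y))"
  using assms unfolding computable_fun2_def by (meson evaluates_comp2)

lemma computable_id: "computable_fun (\<lambda>x. x)"
  unfolding computable_fun_def by (rule exI[of _ "Proj 0"]) (simp add: evaluates_proj)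

lemma computable_fst2: "computable_fun2 (\<lambda>x y. x)"
  unfolding computable_fun2_def by (rule exI[of _ "Proj 0"]) (simp add: evaluates_proj)

lemma computable_snd2: "computable_fun2 (\<lambda>x y. y)"
  unfolding computable_fun2_def by (rule exI[of _ "Proj 1"]) (simp add: evaluates_proj)

lemma computable_Suc': "computable_fun Suc"
  unfolding computable_fun_def using evaluates.succ by blast

lemmas computable_Suc = computable_fun_comp[OF computable_Suc']

lemma computable_const: "computable_fun (\<lambda>x. c)"
proof (induction c)
  case 0
  show ?case
    unfolding computable_fun_def using evaluates.zero by blast
qed (rule computable_Suc)

lemma computable_fun_rec:
  assumes "computable_fun2 h"
  shows "computable_fun (rec_nat 0 h)"
  using assms unfolding computable_fun_def computable_fun2_def
  by (meson evaluates_primrec evaluates.zero)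

text \<open>Here the step sees the parameter but not the counter, in
  \<open>computable_fun_rec\<close> the counter but no parameter. The two forms suffice for the
  arithmetic behind pairing; \<open>computable_rec_nat\<close> later has both.\<close>

lemma computable_fun2_rec:
  assumes "computable_fun f" and "computable_fun2 (\<lambda>y x. h x y)"
  shows "computable_fun2 (\<lambda>n x. rec_nat (f x) (\<lambda>n. h x) n)"
proof -
  obtain p q where p: "evaluates p [x] (f x)" and q: "evaluates q [y, x] (h x y)" for x y
    using assms unfolding computable_fun_def computable_fun2_def by blast
  have "evaluates (Comp q [Proj 1, Proj 2]) [n, y, x] (h x y)" for n y x
    by (rule evaluates_comp2[OF _ _ q]) (auto intro: evaluates_proj)
  from evaluates_primrec[OF p this] show ?thesis
    unfolding computable_fun2_def by blast
qed

lemma computable_fun2_flip: "computable_fun2 f \<Longrightarrow> computable_fun2 (\<lambda>x y. f y x)"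
  by (rule computable_fun2_comp2[OF _ computable_snd2 computable_fst2])

lemma computable_fun2_add: "computable_fun2 (+)"
proof -
  have "rec_nat x (\<lambda>n. Suc) n = n + x" for x n :: nat
    by (induction n) auto
  then show ?thesis
    using computable_fun2_rec[OF computable_id, of "\<lambda>_. Suc"]
      computable_fun2_comp[OF computable_Suc' computable_fst2] by simp
qed

lemma computable_fun2_mult: "computable_fun2 (*)"
proof -
  have "rec_nat 0 (\<lambda>n y. y + x) n = n * x" for x n :: nat
    by (induction n) auto
  then show ?thesis
    using computable_fun2_rec[OF computable_const[of 0], of "\<lambda>x y. y + x"] computable_fun2_add by simp
qed

lemma computable_pred: "computable_fun (\<lambda>x. x - 1)"
proof -
  have "rec_nat 0 (\<lambda>n y. n) = (\<lambda>x. x - 1 :: nat)"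
  proof
    show "rec_nat 0 (\<lambda>n y. n) x = x - 1" for x :: nat
      by (cases x) auto
  qed
  then show ?thesis
    using computable_fun_rec[OF computable_fst2] by simp
qed

lemma computable_fun2_diff: "computable_fun2 (-)"
proof -
  have "rec_nat x (\<lambda>n y. y - 1) n = x - n" for x n :: nat
    by (induction n) auto
  then have "computable_fun2 (\<lambda>n x. x - n)"
    using computable_fun2_rec[OF computable_id, of "\<lambda>_ y. y - 1"]
      computable_fun2_comp[OF computable_pred computable_fst2] by simp
  then show ?thesis
    by (rule computable_fun2_flip)
qed

lemma computable_triangle: "computable_fun triangle"
proof -
  have "rec_nat 0 (\<lambda>n y. Suc (n + y)) = triangle"
  proof
    show "rec_nat 0 (\<lambda>n y. Suc (n + y)) x = triangle x" for x
      by (induction x) auto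
  qed
  then show ?thesis
    using computable_fun_rec[OF computable_fun2_comp[OF computable_Suc' computable_fun2_add]] by simp
qed

lemma computable_fun2_pair: "computable_fun2 (\<lambda>x y. prod_encode (x, y))"
  unfolding prod_encode_def
  by (simp, intro computable_fun2_comp2[OF computable_fun2_add] computable_fst2
      computable_fun2_comp[OF computable_triangle] computable_fun2_add)

lemma computable_Least_zero:
  assumes "computable_fun2 h" and "\<And>x. \<exists>n. h n x = 0"
  shows "computable_fun (\<lambda>x. LEAST n. h n x = 0)"
proof -
  obtain p where "evaluates p [n, x] (h n x)" for n x
    using assms(1) unfolding computable_fun2_def by blast
  then have "evaluates (Mu p) [x] (LEAST n. h n x = 0)" for x
    using assms(2)[of x] evaluates_mu[of p "[x]" "\<lambda>n. h n x"] by blast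
  then show ?thesis
    unfolding computable_fun_def by blast
qed

lemmas computable_add = computable_fun_comp2[OF computable_fun2_add]
lemmas computable_mult = computable_fun_comp2[OF computable_fun2_mult]
lemmas computable_diff = computable_fun_comp2[OF computable_fun2_diff]
lemmas computable_pair = computable_fun_comp2[OF computable_fun2_pair]

text \<open>\<open>prod_encode (m, n)\<close> is \<open>triangle (m + n) + m\<close>, which lies
  below \<open>triangle (Suc (m + n))\<close>; truncated subtraction expresses the comparison as an
  equation with zero. This is what inverts the pairing.\<close>

lemma Least_triangle: "(LEAST k. Suc (prod_encode (m, n)) - triangle (Suc k) = 0) = m + n"
proof (rule Least_equality)
  show "Suc (prod_encode (m, n)) - triangle (Suc (m + n)) = 0"
    by (simp add: prod_encode_def)
  have "mono triangle"
    by (rule monoI, rule lift_Suc_mono_le[of triangle]) simp_all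
  then have "triangle (Suc k) \<le> triangle (m + n)" if "k < m + n" for k
    using that by (simp add: mono_def del: triangle_Suc)
  then show "m + n \<le> k" if "Suc (prod_encode (m, n)) - triangle (Suc k) = 0" for k
    using that by (fastforce simp: prod_encode_def not_less[symmetric] simp del: triangle_Suc)
qed

lemma computable_unpair:
  shows "computable_fun (\<lambda>z. fst (prod_decode z))" and "computable_fun (\<lambda>z. snd (prod_decode z))"
proof -
  define w where "w z = (LEAST k. Suc z - triangle (Suc k) = 0)" for z
  have w: "w z = fst (prod_decode z) + snd (prod_decode z)" for z
    using Least_triangle[of "fst (prod_decode z)" "snd (prod_decode z)"] by (simp add: w_def)
  have "computable_fun w"
    unfolding w_def
  proof (rule computable_Least_zero)
    show "computable_fun2 (\<lambda>n z. Suc z - triangle (Suc n))"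
      by (intro computable_fun2_comp2[OF computable_fun2_diff] computable_fun2_comp[OF computable_Suc']
          computable_snd2 computable_fst2 computable_fun2_comp[OF computable_triangle])
    show "\<exists>n. Suc z - triangle (Suc n) = 0" for z
      by (rule exI[of _ z]) simp
  qed
  moreover have "fst (prod_decode z) = z - triangle (w z)" for z
    using prod_decode_inverse[of z] w[of z] by (cases "prod_decode z") (auto simp: prod_encode_def)
  ultimately show fst: "computable_fun (\<lambda>z. fst (prod_decode z))"
    by (simp add: computable_diff computable_id computable_fun_comp[OF computable_triangle])
  show "computable_fun (\<lambda>z. snd (prod_decode z))"
    using computable_diff[OF \<open>computable_fun w\<close> fst] by (simp add: w)
qed

lemmas computable_fst = computable_fun_comp[OF computable_unpair(1)]
lemmas computable_snd = computable_fun_comp[OF computable_unpair(2)]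

lemma computable_fun2I:
  assumes "computable_fun (\<lambda>z. f (fst (prod_decode z)) (snd (prod_decode z)))"
  shows "computable_fun2 f"
  using computable_fun2_comp[OF assms computable_fun2_pair] by simp

section \<open>Decidable predicates, bounded quantifiers and unbounded search\<close>

definition decidable :: "(nat \<Rightarrow> bool) \<Rightarrow> bool" where
  "decidable P \<longleftrightarrow> computable_set (Collect P)"

lemma decidable_iff: "decidable P \<longleftrightarrow> computable_fun (\<lambda>x. if P x then 1 else 0)"
  by (simp add: decidable_def computable_set_def)

lemma decidable_comp: "decidable P \<Longrightarrow> computable_fun f \<Longrightarrow> decidable (\<lambda>x. P (f x))"
  unfolding decidable_iff by (rule computable_fun_comp)

lemma decidable_less:
  assumes "computable_fun f" and "computable_fun g"
  shows "decidable (\<lambda>x. f x < g x)"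
proof -
  \<comment> \<open>The truncated difference is positive iff \<open>f x < g x\<close>; subtracting
    from 1 twice turns a positive number into 1.\<close>
  have "(if f x < g x then 1 else 0) = 1 - (1 - (g x - f x))" for x
    by auto
  then show ?thesis
    unfolding decidable_iff by (simp only:) (intro computable_diff computable_const assms)
qed

lemma decidable_not:
  assumes "decidable P"
  shows "decidable (\<lambda>x. \<not> P x)"
proof -
  have "(if \<not> P x then 1 else 0) = 1 - (if P x then 1 else (0::nat))" for x
    by auto
  then show ?thesis
    using assms unfolding decidable_iff by (simp only:) (intro computable_diff computable_const)
qed

lemma decidable_conj:
  assumes "decidable P" and "decidable Q"
  shows "decidable (\<lambda>x. P x \<and> Q x)"
proof -
  have "(if P x \<and> Q x then 1 else 0) = (if P x then 1 else 0) * (if Q x then 1 else (0::nat))" for x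
    by auto
  then show ?thesis
    using assms unfolding decidable_iff by (simp only:) (intro computable_mult)
qed

lemma decidable_imp: "decidable P \<Longrightarrow> decidable Q \<Longrightarrow> decidable (\<lambda>x. P x \<longrightarrow> Q x)"
  using decidable_not[OF decidable_conj[OF _ decidable_not]] by simp

lemma decidable_disj: "decidable P \<Longrightarrow> decidable Q \<Longrightarrow> decidable (\<lambda>x. P x \<or> Q x)"
  using decidable_imp[OF decidable_not] by (simp add: imp_conv_disj)

lemma decidable_le:
  assumes "computable_fun f" and "computable_fun g"
  shows "decidable (\<lambda>x. f x \<le> g x)"
  using decidable_not[OF decidable_less[OF assms(2,1)]] by (simp add: not_less)

lemma decidable_eq:
  assumes "computable_fun f" and "computable_fun g"
  shows "decidable (\<lambda>x. f x = g x)"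
  using decidable_conj[OF decidable_le[OF assms] decidable_le[OF assms(2,1)]]
  by (simp add: order_eq_iff[symmetric])

lemma decidable_finite_Bex:
  assumes "finite K" and "\<And>k. k \<in> K \<Longrightarrow> decidable (P k)"
  shows "decidable (\<lambda>x. \<exists>k\<in>K. P k x)"
  using assms
proof (induction K)
  case empty
  show ?case
    using computable_const by (simp add: decidable_iff)
qed (simp add: decidable_disj)

lemma decidable_finite_Ball:
  assumes "finite K" and "\<And>k. k \<in> K \<Longrightarrow> decidable (P k)"
  shows "decidable (\<lambda>x. \<forall>k\<in>K. P k x)"
  using decidable_not[OF decidable_finite_Bex[OF assms(1) decidable_not[OF assms(2)]]] by simp

text \<open>The predicate is read off a coded pair, search variable first and parameter second, so
  that the rules for unary predicates also apply below a quantifier. \<open>decidable_Ex\<close> and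
  \<open>decidable_All\<close> follow the same convention.\<close>

lemma computable_Least:
  assumes "decidable (\<lambda>z. P (fst (prod_decode z)) (snd (prod_decode z)))" and "\<And>x. \<exists>n. P n x"
  shows "computable_fun (\<lambda>x. LEAST n. P n x)"
proof -
  \<comment> \<open>The search is for a zero, hence the characteristic function of the
    negation.\<close>
  have "computable_fun2 (\<lambda>n x. if \<not> P n x then 1 else 0)"
    using decidable_not[OF assms(1)] unfolding decidable_iff by (rule computable_fun2I)
  moreover have "(if \<not> P n x then 1 else 0 :: nat) = 0 \<longleftrightarrow> P n x" for n x
    by simp
  ultimately show ?thesis
    using computable_Least_zero[of "\<lambda>n x. if \<not> P n x then 1 else 0"] assms(2) by (simp only:)
qed

lemma decidable_Ex:
  assumes "computable_fun b" and "decidable (\<lambda>z. P (fst (prod_decode z)) (snd (prod_decode z)))"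
  shows "decidable (\<lambda>x. \<exists>n<b x. P n x)"
proof -
  \<comment> \<open>Stopping at \<open>b x\<close> makes the search total; it ends below
    \<open>b x\<close> iff a witness exists.\<close>
  define m where "m x = (LEAST n. P n x \<or> b x \<le> n)" for x
  have "computable_fun m"
    unfolding m_def
    by (rule computable_Least, intro decidable_disj assms decidable_le computable_fun_comp[OF assms(1)]
        computable_unpair) auto
  moreover have "m x < b x \<longleftrightarrow> (\<exists>n<b x. P n x)" for x
  proof
    assume "m x < b x"
    moreover have "P (m x) x \<or> b x \<le> m x"
      unfolding m_def by (rule LeastI[of _ "b x"]) simp
    ultimately show "\<exists>n<b x. P n x"
      by auto
  next
    assume "\<exists>n<b x. P n x"
    then show "m x < b x"
      unfolding m_def by (metis (mono_tags, lifting) Least_le order.strict_trans1)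
  qed
  ultimately show ?thesis
    using decidable_less[OF _ assms(1), of m] by simp
qed

lemma decidable_All:
  assumes "computable_fun b" and "decidable (\<lambda>z. P (fst (prod_decode z)) (snd (prod_decode z)))"
  shows "decidable (\<lambda>x. \<forall>n<b x. P n x)"
  using decidable_not[OF decidable_Ex[OF assms(1) decidable_not[OF assms(2)]]] by simp

text \<open>The search is known to succeed only at the values \<open>f n\<close>, so its result need
  not be defined for all \<open>n\<close> and \<open>y\<close>, and recursion with a total step does
  not apply. The term is therefore evaluated directly, by induction along the values of
  \<open>f\<close>.\<close>

lemma computable_iterated_Least:
  assumes "decidable (\<lambda>z. P (fst (prod_decode z)) (fst (prod_decode (snd (prod_decode z))))
      (snd (prod_decode (snd (prod_decode z)))))"
    and "computable_fun g"
    and "f 0 = 0" and "\<And>n. f (Suc n) = g (LEAST e. P n (f n) e)" and "\<And>n. \<exists>e. P n (f n) e"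
  shows "computable_fun f"
proof -
  obtain p q r where p: "evaluates p [x, y] (prod_encode (x, y))" and q: "evaluates q [x] (g x)"
    and r: "evaluates r [z] (if \<not> P (fst (prod_decode z)) (fst (prod_decode (snd (prod_decode z))))
      (snd (prod_decode (snd (prod_decode z)))) then 1 else 0)" for x y z
    using decidable_not[OF assms(1)] assms(2) computable_fun2_pair
    unfolding decidable_iff computable_fun_def computable_fun2_def by blast
  \<comment> \<open>\<open>Mu\<close> puts the search variable \<open>e\<close> first, whereas
    \<open>P\<close> is coded with it last; the projections reorder the arguments.\<close>
  define t where "t = Comp r [Comp p [Proj 1, Comp p [Proj 2, Proj 0]]]"
  have t: "evaluates t [e, n, y] (if \<not> P n y e then 1 else 0)" for e n y
    unfolding t_def
    using evaluates_comp1[OF evaluates_comp2[OF _ evaluates_comp2[OF _ _ p] p] r,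
        of "Proj 1" "[e, n, y]" n "Proj 2" y "Proj 0" e]
    by (simp add: evaluates_proj)
  have "evaluates (PrimRec Zero (Comp q [Mu t])) [n] (f n)" for n
  proof (induction n)
    case 0
    show ?case
      unfolding assms(3) by (intro evaluates.primrec_0 evaluates.zero)
  next
    case (Suc n)
    have eq: "(if \<not> P n (f n) e then 1 else 0 :: nat) = 0 \<longleftrightarrow> P n (f n) e" for e
      by simp
    obtain e where "(if \<not> P n (f n) e then 1 else 0 :: nat) = 0"
      using assms(5)[of n] by auto
    from evaluates_mu[of t "[n, f n]", OF t this]
    have "evaluates (Mu t) [n, f n] (LEAST e. P n (f n) e)"
      unfolding eq .
    then show ?case
      unfolding assms(4) by (intro evaluates.primrec_Suc[OF Suc] evaluates_comp1[OF _ q])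
  qed
  then show ?thesis
    unfolding computable_fun_def by blast
qed

section \<open>General recursion, powers, iterates, quotients and binary digits\<close>

lemma computable_rec_nat:
  assumes "computable_fun a" and "computable_fun b"
    and "computable_fun (\<lambda>z. h (fst (prod_decode z)) (fst (prod_decode (snd (prod_decode z))))
           (snd (prod_decode (snd (prod_decode z)))))"
  shows "computable_fun (\<lambda>x. rec_nat (a x) (\<lambda>n y. h n y x) (b x))"
proof -
  obtain p q r where p: "evaluates p [x] (a x)" and r: "evaluates r [x, y] (prod_encode (x, y))"
    and q: "evaluates q [z] (h (fst (prod_decode z)) (fst (prod_decode (snd (prod_decode z))))
        (snd (prod_decode (snd (prod_decode z)))))" for x y z
    using assms(1,3) computable_fun2_pair unfolding computable_fun_def computable_fun2_def by blast
  have "evaluates (Comp q [Comp r [Proj 0, Comp r [Proj 1, Proj 2]]]) [n, y, x] (h n y x)" for n y x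
    using evaluates_comp1[OF evaluates_comp2[OF _ evaluates_comp2[OF _ _ r] r] q,
        of "Proj 0" "[n, y, x]" n "Proj 1" y "Proj 2" x]
    by (simp add: evaluates_proj)
  from evaluates_primrec[OF p this]
  have "computable_fun2 (\<lambda>k x. rec_nat (a x) (\<lambda>n y. h n y x) k)"
    unfolding computable_fun2_def by blast
  from computable_fun_comp2[OF this assms(2) computable_id] show ?thesis .
qed

lemma computable_power: "computable_fun f \<Longrightarrow> computable_fun (\<lambda>x. c ^ f x)"
proof -
  assume f: "computable_fun f"
  have "rec_nat 1 (\<lambda>n y. c * y) k = c ^ k" for k
    by (induction k) auto
  then show ?thesis
    using computable_rec_nat[OF computable_const[of 1] f, of "\<lambda>n y x. c * y"]
    by (simp add: computable_mult computable_const computable_fst computable_snd computable_id)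
qed

lemma computable_funpow:
  assumes "computable_fun g" "computable_fun f" and "computable_fun a"
  shows "computable_fun (\<lambda>x. (g ^^ f x) (a x))"
proof -
  have "rec_nat y (\<lambda>n. g) k = (g ^^ k) y" for k y
    by (induction k) auto
  then show ?thesis
    using computable_rec_nat[OF assms(3,2), of "\<lambda>n y x. g y"]
    by (simp add: computable_fun_comp[OF assms(1)] computable_fst computable_snd computable_id)
qed

lemma computable_div:
  assumes "computable_fun f" and "computable_fun g" and "\<And>x. g x > 0"
  shows "computable_fun (\<lambda>x. f x div g x)"
proof -
  have "(LEAST q. f x < g x * Suc q) = f x div g x" for x
  proof (rule Least_equality)
    show "f x < g x * Suc (f x div g x)"
      using dividend_less_times_div[OF assms(3)] by (simp add: algebra_simps)
    show "f x div g x \<le> q" if "f x < g x * Suc q" for q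
      using less_mult_imp_div_less[of "f x" "Suc q" "g x"] that by (simp add: algebra_simps)
  qed
  moreover have "\<exists>q. f x < g x * Suc q" for x
    by (metis assms(3) dividend_less_times_div mult_Suc_right)
  moreover have "decidable (\<lambda>z. f (snd (prod_decode z)) < g (snd (prod_decode z)) * Suc (fst (prod_decode z)))"
    by (intro decidable_less computable_mult computable_Suc computable_fun_comp[OF assms(1)]
        computable_fun_comp[OF assms(2)] computable_unpair)
  ultimately show ?thesis
    using computable_Least[of "\<lambda>q x. f x < g x * Suc q"] by (simp only:)
qed

lemma decidable_in_set_decode:
  assumes "computable_fun f" and "computable_fun g"
  shows "decidable (\<lambda>x. f x \<in> set_decode (g x))"
proof -
  \<comment> \<open>Membership means that bit \<open>f x\<close> of \<open>g x\<close> is set; a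
    number \<open>a\<close> is odd iff \<open>2 * (a div 2) < a\<close>.\<close>
  have "f x \<in> set_decode (g x) \<longleftrightarrow> 2 * (g x div 2 ^ f x div 2) < g x div 2 ^ f x" for x
    unfolding set_decode_def by (auto elim: oddE evenE)
  then show ?thesis
    by (simp only:) (intro decidable_less computable_mult computable_const computable_div
        computable_power assms; simp)
qed

lemmas computable_intros = computable_id computable_const computable_Suc computable_add
  computable_mult computable_pair computable_fst computable_snd computable_div
  decidable_less decidable_le decidable_eq decidable_not decidable_conj decidable_disj decidable_imp
  decidable_Ex decidable_All decidable_in_set_decode computable_funpow

section \<open>Matchings\<close>

text \<open>Induction on \<open>card A\<close> after Halmos and Vaughan. If a proper nonempty
  \<open>F\<close> has exactly \<open>card F\<close> neighbours, \<open>F\<close> and the rest are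
  matched separately; otherwise every such set has a neighbour to spare and any single edge may be
  fixed first.\<close>

lemma finite_hall:
  fixes N :: "'a \<Rightarrow> 'b set"
  assumes "finite A" and "\<And>a. a \<in> A \<Longrightarrow> finite (N a)"
    and "\<And>F. F \<subseteq> A \<Longrightarrow> card F \<le> card (\<Union>(N ` F))"
  shows "\<exists>f. inj_on f A \<and> (\<forall>a\<in>A. f a \<in> N a)"
  using assms
proof (induction "card A" arbitrary: A N rule: less_induct)
  case less
  note fin = less.prems(1,2) and hall = less.prems(3)
  consider (empty) "A = {}" | (tight) F where "F \<subset> A" "F \<noteq> {}" "card (\<Union>(N ` F)) = card F"
    | (slack) "A \<noteq> {}" "\<And>F. F \<subset> A \<Longrightarrow> F \<noteq> {} \<Longrightarrow> card F < card (\<Union>(N ` F))"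
    using hall by (metis le_neq_implies_less psubset_imp_subset)
  then show ?case
  proof cases
    case empty
    then show ?thesis by simp
  next
    case tight
    have F: "finite F"
      using fin tight(1) by (meson finite_subset psubset_imp_subset)
    define N' where "N' a = N a - \<Union>(N ` F)" for a
    have "\<exists>f. inj_on f F \<and> (\<forall>a\<in>F. f a \<in> N a)"
      using tight(1) fin hall F by (intro less.hyps psubset_card_mono) auto
    moreover have "\<exists>f. inj_on f (A - F) \<and> (\<forall>a\<in>A - F. f a \<in> N' a)"
    proof (intro less.hyps)
      show "card (A - F) < card A"
        using tight(1,2) fin by (intro psubset_card_mono) auto
      fix H assume H: "H \<subseteq> A - F"
      \<comment> \<open>Counting \<open>H \<union> F\<close> instead of \<open>H\<close> gives
        Hall's condition outside \<open>F\<close>, as \<open>F\<close> accounts for exactly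
        \<open>card F\<close> of the neighbours.\<close>
      have "card H + card F = card (H \<union> F)"
        using H F fin by (subst card_Un_disjoint) (auto intro: finite_subset)
      also have "\<dots> \<le> card (\<Union>(N ` (H \<union> F)))"
        using H tight(1) by (intro hall) auto
      also have "\<Union>(N ` (H \<union> F)) = \<Union>(N' ` H) \<union> \<Union>(N ` F)"
        by (auto simp: N'_def)
      also have "card \<dots> \<le> card (\<Union>(N' ` H)) + card (\<Union>(N ` F))"
        by (rule card_Un_le)
      finally show "card H \<le> card (\<Union>(N' ` H))"
        using tight(3) by simp
    qed (use fin in \<open>auto simp: N'_def\<close>)
    ultimately obtain f g where f: "inj_on f F" "\<And>a. a \<in> F \<Longrightarrow> f a \<in> N a"
      and g: "inj_on g (A - F)" "\<And>a. a \<in> A - F \<Longrightarrow> g a \<in> N' a"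
      by blast
    show ?thesis
    proof (intro exI conjI)
      show "inj_on (\<lambda>a. if a \<in> F then f a else g a) A"
        using f g unfolding inj_on_def N'_def by (metis DiffD2 DiffI UN_I)
      show "\<forall>a\<in>A. (if a \<in> F then f a else g a) \<in> N a"
        using f g by (auto simp: N'_def)
    qed
  next
    case slack
    from slack(1) obtain a where a: "a \<in> A" by blast
    have "N a \<noteq> {}"
      using hall[of "{a}"] a by auto
    then obtain b where b: "b \<in> N a" by blast
    have "\<exists>f. inj_on f (A - {a}) \<and> (\<forall>x\<in>A - {a}. f x \<in> N x - {b})"
    proof (intro less.hyps)
      show "card (A - {a}) < card A"
        using a fin by (intro psubset_card_mono) auto
      fix H assume "H \<subseteq> A - {a}"
      with a have "H \<subset> A"
        by auto
      \<comment> \<open>Deleting \<open>b\<close> costs at most one neighbour, which the strict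
        inequality affords.\<close>
      have "card H \<le> card (\<Union>(N ` H)) - 1"
        using slack(2)[OF \<open>H \<subset> A\<close>] by (cases "H = {}") auto
      also have "\<dots> \<le> card (\<Union>(N ` H) - {b})"
        by (simp add: card_Diff_singleton_if)
      also have "\<Union>(N ` H) - {b} = (\<Union>x\<in>H. N x - {b})"
        by auto
      finally show "card H \<le> card (\<Union>x\<in>H. N x - {b})" .
    qed (use fin in auto)
    then obtain f where f: "inj_on f (A - {a})" "\<And>x. x \<in> A - {a} \<Longrightarrow> f x \<in> N x - {b}"
      by blast
    show ?thesis
    proof (intro exI conjI)
      show "inj_on (f(a := b)) A"
        using f unfolding inj_on_def by (metis DiffD2 DiffI fun_upd_apply insertE insertI1 singletonD)
      show "\<forall>x\<in>A. (f(a := b)) x \<in> N x"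
        using f b by auto
    qed
  qed
qed

definition matching :: "('a \<Rightarrow> 'b \<Rightarrow> bool) \<Rightarrow> ('a \<times> 'b) set \<Rightarrow> bool" where
  "matching E M \<longleftrightarrow> M \<subseteq> {(u, v). E u v} \<and> inj_on fst M \<and> inj_on snd M"

text \<open>
  The Mendelsohn--Dulmage theorem: as in Banach's proof of the Schroeder--Bernstein theorem, a fixed
  point \<open>T\<close> separates the part of \<open>B\<close> that is matched by \<open>g\<close> from the part that is matched by \<open>f\<close>.
\<close>

lemma mendelsohn_dulmage:
  assumes "inj_on f A" and "\<And>u. u \<in> A \<Longrightarrow> E u (f u)"
    and "inj_on g B" and "\<And>v. v \<in> B \<Longrightarrow> E (g v) v"
  shows "\<exists>M\<subseteq>(\<lambda>u. (u, f u)) ` A \<union> (\<lambda>v. (g v, v)) ` B. matching E M \<and> A \<subseteq> fst ` M \<and> B \<subseteq> snd ` M"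
proof -
  define T where "T = lfp (\<lambda>T. B - f ` (A - g ` T))"
  have T: "T = B - f ` (A - g ` T)"
    unfolding T_def by (rule lfp_unfold) (intro monoI Diff_mono image_mono order_refl)
  define M where "M = (\<lambda>u. (u, f u)) ` (A - g ` T) \<union> (\<lambda>v. (g v, v)) ` T"
  have fst: "fst ` M = (A - g ` T) \<union> g ` T" and snd: "snd ` M = f ` (A - g ` T) \<union> T"
    by (auto simp: M_def image_image image_Un)
  have "T \<subseteq> B" and T': "T \<inter> f ` (A - g ` T) = {}"
    using T by auto
  then have f: "inj_on f (A - g ` T)" and g: "inj_on g T"
    using assms(1,3) by (auto intro: inj_on_subset)
  show ?thesis
  proof (intro exI conjI)
    show "M \<subseteq> (\<lambda>u. (u, f u)) ` A \<union> (\<lambda>v. (g v, v)) ` B"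
      using \<open>T \<subseteq> B\<close> by (auto simp: M_def)
    have "inj_on fst M"
      unfolding M_def by (rule inj_onI) (use g in \<open>auto dest: inj_onD\<close>)
    moreover have "inj_on snd M"
      unfolding M_def by (rule inj_onI) (use f T' in \<open>auto dest: inj_onD\<close>)
    ultimately show "matching E M"
      using assms \<open>T \<subseteq> B\<close> unfolding matching_def M_def by auto
    show "A \<subseteq> fst ` M"
      unfolding fst by auto
    show "B \<subseteq> snd ` M"
      unfolding snd using T by auto
  qed
qed

text \<open>The traces \<open>F \<inter> W j\<close> increase within \<open>F\<close>, so at most
  \<open>card F\<close> of the first \<open>m\<close> inclusions can be strict.\<close>

lemma stable_intersection:
  assumes "finite F" and "card F < m" and "\<And>j. W j \<subseteq> W (Suc j)"
  shows "\<exists>j<m. F \<inter> W (Suc j) = F \<inter> W j"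
proof (rule ccontr)
  assume *: "\<not> (\<exists>j<m. F \<inter> W (Suc j) = F \<inter> W j)"
  have "j \<le> card (F \<inter> W j)" if "j \<le> m" for j
    using that
  proof (induction j)
    case (Suc j)
    then have "F \<inter> W j \<subset> F \<inter> W (Suc j)"
      using * assms(3)[of j] by (metis Int_mono Suc_le_lessD order_refl psubsetI)
    then have "card (F \<inter> W j) < card (F \<inter> W (Suc j))"
      using assms(1) by (intro psubset_card_mono) auto
    then show ?case
      using Suc by simp
  qed simp
  then have "m \<le> card (F \<inter> W m)"
    by simp
  also have "\<dots> \<le> card F"
    using assms(1) by (intro card_mono) auto
  finally show False
    using assms(2) by simp
qed

text \<open>
  A set \<open>F\<close> violating Hall's condition after the removal of \<open>V\<close> has fewer than \<open>m\<close> elements. It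
  splits into its part within some \<open>W j\<close> and a part that shares no neighbour with it and has none
  in \<open>V\<close>; the latter expands, so the former is a violation within \<open>W m\<close> already.
\<close>

lemma residual_hall:
  fixes N :: "'a \<Rightarrow> 'b set"
  assumes "\<And>u. finite (N u)"
    and expand: "\<And>F. finite F \<Longrightarrow> 2 * card F \<le> card (\<Union>(N ` F))"
    and V: "finite V" "card V \<le> m"
    and W: "\<And>j. W j \<subseteq> W (Suc j)" "\<And>u. N u \<inter> V \<noteq> {} \<Longrightarrow> u \<in> W 0"
      "\<And>j u u'. u \<in> W j \<Longrightarrow> N u \<inter> N u' \<noteq> {} \<Longrightarrow> u' \<in> W (Suc j)"
    and f: "inj_on f (W m - U)" "\<And>u. u \<in> W m - U \<Longrightarrow> f u \<in> N u - V"
    and F: "finite F" "F \<inter> U = {}"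
  shows "card F \<le> card (\<Union>u\<in>F. N u - V)"
proof (cases "card F < m")
  case False
  \<comment> \<open>Of at least \<open>2 * card F\<close> neighbours, at most
    \<open>m \<le> card F\<close> are removed.\<close>
  have "2 * card F \<le> card (\<Union>(N ` F))"
    by (rule expand[OF F(1)])
  also have "\<dots> \<le> card ((\<Union>u\<in>F. N u - V) \<union> V)"
    using F assms(1) V(1) by (intro card_mono) auto
  also have "\<dots> \<le> card (\<Union>u\<in>F. N u - V) + card V"
    by (rule card_Un_le)
  finally show ?thesis
    using False V by simp
next
  case True
  then obtain j where "j < m" and j: "F \<inter> W (Suc j) = F \<inter> W j"
    using stable_intersection[of F m W] F(1) W(1) by blast
  define F1 where "F1 = F \<inter> W j"
  define F2 where "F2 = F - W j"
  have mono: "W i \<subseteq> W k" if "i \<le> k" for i k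
    using lift_Suc_mono_le[of W, OF W(1) that] .
  have fin: "finite F1" "finite F2"
    using F by (auto simp: F1_def F2_def)
  have "F1 \<subseteq> W m - U"
    using F mono[of j m] \<open>j < m\<close> by (auto simp: F1_def)
  then have "card F1 = card (f ` F1)"
    using card_image[OF inj_on_subset[OF f(1)], of F1] by simp
  also have "\<dots> \<le> card (\<Union>u\<in>F1. N u - V)"
    using \<open>F1 \<subseteq> W m - U\<close> f(2) fin assms(1) by (intro card_mono) auto
  finally have F1: "card F1 \<le> card (\<Union>u\<in>F1. N u - V)" .
  \<comment> \<open>A vertex outside \<open>W j\<close> is outside \<open>W 0\<close>, so none of
    its neighbours is in \<open>V\<close>.\<close>
  have "(\<Union>u\<in>F2. N u - V) = \<Union>(N ` F2)"
    using W(2) mono[of 0 j] by (fastforce simp: F2_def)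
  then have F2: "card F2 \<le> card (\<Union>u\<in>F2. N u - V)"
    using expand[OF fin(2)] by simp
  \<comment> \<open>A vertex sharing a neighbour with \<open>F1\<close> lies in
    \<open>W (Suc j)\<close>, where by the choice of \<open>j\<close> there is no vertex of
    \<open>F2\<close>.\<close>
  have "N u \<inter> N u' = {}" if "u \<in> F1" "u' \<in> F2" for u u'
    using that W(3)[of u j u'] j by (auto simp: F1_def F2_def)
  then have "(\<Union>u\<in>F1. N u - V) \<inter> (\<Union>u\<in>F2. N u - V) = {}"
    by fast
  then have "card ((\<Union>u\<in>F1. N u - V) \<union> (\<Union>u\<in>F2. N u - V))
      = card (\<Union>u\<in>F1. N u - V) + card (\<Union>u\<in>F2. N u - V)"
    using fin assms(1) by (intro card_Un_disjoint) auto
  moreover have "F = F1 \<union> F2"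
    by (auto simp: F1_def F2_def)
  moreover have "card F = card F1 + card F2"
    unfolding \<open>F = F1 \<union> F2\<close> using fin by (intro card_Un_disjoint) (auto simp: F1_def F2_def)
  ultimately show ?thesis
    using F1 F2 by (simp add: UN_Un Un_Diff)
qed

section \<open>Computable perfect matchings in expanding graphs\<close>

lemma matching_subset: "matching E M' \<Longrightarrow> M \<subseteq> M' \<Longrightarrow> matching E M"
  unfolding matching_def by (meson inj_on_subset subset_trans)

lemma matching_Un:
  assumes "matching E M" and "matching E M'"
    and "fst ` M \<inter> fst ` M' = {}" and "snd ` M \<inter> snd ` M' = {}"
  shows "matching E (M \<union> M')"
  using assms unfolding matching_def inj_on_Un by fast

lemma matching_left_unique: "matching E M \<Longrightarrow> (u, v) \<in> M \<Longrightarrow> (u', v) \<in> M \<Longrightarrow> u = u'"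
  unfolding matching_def inj_on_def by fastforce

lemma matching_right_unique: "matching E M \<Longrightarrow> (u, v) \<in> M \<Longrightarrow> (u, v') \<in> M \<Longrightarrow> v = v'"
  unfolding matching_def inj_on_def by fastforce

lemma matching_edge: "matching E M \<Longrightarrow> (u, v) \<in> M \<Longrightarrow> E u v"
  unfolding matching_def by blast

lemma matching_converse: "matching E M \<Longrightarrow> matching (\<lambda>v u. E u v) (prod.swap ` M)"
  unfolding matching_def inj_on_def by fastforce

text \<open>Both sides of the bipartite graph are copies of the natural numbers. The bound
  \<open>\<beta>\<close> makes neighbourhoods finite, and its iterates yield balls around finite
  sets.\<close>

locale expanding_graph =
  fixes E :: "nat \<Rightarrow> nat \<Rightarrow> bool" and \<beta> :: "nat \<Rightarrow> nat"
  assumes bound_0: "\<beta> 0 = 0"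
    and bound_ge: "n \<le> \<beta> n"
    and bound_right: "E u v \<Longrightarrow> u < n \<Longrightarrow> v < \<beta> n"
    and bound_left: "E u v \<Longrightarrow> v < n \<Longrightarrow> u < \<beta> n"
    and expand_right: "finite F \<Longrightarrow> 2 * card F \<le> card {v. \<exists>u\<in>F. E u v}"
    and expand_left: "finite F \<Longrightarrow> 2 * card F \<le> card {u. \<exists>v\<in>F. E u v}"
begin

lemma converse: "expanding_graph (\<lambda>v u. E u v) \<beta>"
  by unfold_locales
    (use bound_0 bound_ge bound_right bound_left expand_right expand_left in blast)+

lemma finite_right: "finite {v. E u v}"
  by (rule finite_subset[of _ "{..<\<beta> (Suc u)}"]) (auto intro: bound_right)

lemma finite_left: "finite {u. E u v}"
  by (rule finite_subset[of _ "{..<\<beta> (Suc v)}"]) (auto intro: bound_left)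

text \<open>Left vertices adjacent to a right vertex below \<open>c\<close> are below
  \<open>\<beta> c\<close>; passing to left vertices that share a neighbour costs two more
  applications of \<open>\<beta>\<close>, and this is done \<open>c\<close> times. Here
  \<open>c\<close> bounds both the vertices of a matching and the number of right vertices it
  removes.\<close>

definition radius :: "nat \<Rightarrow> nat" where
  "radius c = (\<beta> ^^ (2 * c + 1)) c"

text \<open>\<open>residual_hall\<close> is applied with the sets below iterates of
  \<open>\<beta>\<close> as \<open>W\<close>. Within the largest of these the partners in
  \<open>M'\<close> form the choice function \<open>f\<close>; outside the left vertices of
  \<open>M\<close> it avoids the right ones, because \<open>M'\<close> is a matching containing
  \<open>M\<close>.\<close>

lemma residual_choice:
  assumes M': "matching E M'" "M \<subseteq> M'" and M: "M \<subseteq> {..<c} \<times> {..<c}"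
    and cover: "{..<radius c} \<subseteq> fst ` M'"
    and A: "finite A" "A \<inter> fst ` M = {}"
  shows "\<exists>f. inj_on f A \<and> (\<forall>u\<in>A. f u \<in> {v. E u v} - snd ` M)"
proof (rule finite_hall)
  define W where "W j = {..<(\<beta> ^^ (2 * j + 1)) c}" for j
  have snd: "snd ` M \<subseteq> {..<c}"
    using M by auto
  define f where "f u = (SOME v. (u, v) \<in> M')" for u
  have f: "(u, f u) \<in> M'" if "u \<in> W c" for u
    using that cover unfolding f_def W_def radius_def
    by (metis (mono_tags, lifting) imageE prod.collapse someI subsetD)
  fix F assume F: "F \<subseteq> A"
  show "card F \<le> card (\<Union>u\<in>F. {v. E u v} - snd ` M)"
  proof (rule residual_hall)
    show "2 * card F \<le> card (\<Union>u\<in>F. {v. E u v})" if "finite F" for F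
    proof -
      have "(\<Union>u\<in>F. {v. E u v}) = {v. \<exists>u\<in>F. E u v}"
        by auto
      then show ?thesis
        using expand_right[OF that] by simp
    qed
    show "finite (snd ` M)" "card (snd ` M) \<le> c"
      using snd finite_subset card_mono[OF _ snd] by auto
    show "W j \<subseteq> W (Suc j)" for j
      using bound_ge by (auto simp: W_def intro: order.strict_trans2 order_trans)
    show "u \<in> W 0" if "{v. E u v} \<inter> snd ` M \<noteq> {}" for u
      using that snd bound_left by (auto simp: W_def)
    show "u' \<in> W (Suc j)" if "u \<in> W j" "{v. E u v} \<inter> {v. E u' v} \<noteq> {}" for j u u'
      using that bound_left bound_right by (auto simp: W_def)
    show "inj_on f (W c - fst ` M)"
      using f matching_left_unique[OF M'(1)] by (intro inj_onI) (metis DiffD1)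
    show "f u \<in> {v. E u v} - snd ` M" if "u \<in> W c - fst ` M" for u
    proof -
      have "E u (f u)"
        using f that matching_edge[OF M'(1)] by blast
      moreover have "f u \<notin> snd ` M"
      proof
        assume "f u \<in> snd ` M"
        then obtain u' where "(u', f u) \<in> M"
          by auto
        then have "u' = u"
          using f[of u] that M'(2) matching_left_unique[OF M'(1)] by blast
        then show False
          using \<open>(u', f u) \<in> M\<close> that by force
      qed
      ultimately show ?thesis
        by blast
    qed
    show "finite F" "F \<inter> fst ` M = {}"
      using F A by (auto intro: finite_subset)
  qed (rule finite_right)
qed (use A finite_right in auto)

text \<open>A finitary stand-in for being part of a perfect matching: only finite matchings occur,
  and the sets to be covered may be chosen after \<open>M\<close>.\<close>

definition extendable :: "(nat \<times> nat) set \<Rightarrow> bool" where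
  "extendable M \<longleftrightarrow> (\<forall>A B. finite A \<longrightarrow> finite B \<longrightarrow>
    (\<exists>M'. matching E M' \<and> finite M' \<and> M \<subseteq> M' \<and> A \<subseteq> fst ` M' \<and> B \<subseteq> snd ` M'))"

lemma extendable_imp_matching: "extendable M \<Longrightarrow> matching E M"
  unfolding extendable_def using matching_subset finite.emptyI by meson

text \<open>The covered balls give injective choices of partners outside \<open>M\<close> in both
  directions, the second by applying \<open>residual_choice\<close> to the converse graph;
  \<open>mendelsohn_dulmage\<close> merges them into one matching that can be added to
  \<open>M\<close>.\<close>

lemma extendable_if_covered:
  assumes M': "matching E M'" "M \<subseteq> M'" and M: "M \<subseteq> {..<c} \<times> {..<c}"
    and cover: "{..<radius c} \<subseteq> fst ` M'" "{..<radius c} \<subseteq> snd ` M'"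
  shows "extendable M"
  unfolding extendable_def
proof (intro allI impI)
  fix A B :: "nat set"
  assume fin: "finite A" "finite B"
  interpret dual: expanding_graph "\<lambda>v u. E u v" \<beta>
    by (rule converse)
  have swap: "fst ` prod.swap ` X = snd ` X" "snd ` prod.swap ` X = fst ` X"
    for X :: "(nat \<times> nat) set"
    by (simp_all add: image_image)
  obtain f where f: "inj_on f (A - fst ` M)" "\<And>u. u \<in> A - fst ` M \<Longrightarrow> f u \<in> {v. E u v} - snd ` M"
    using residual_choice[OF M' M cover(1), of "A - fst ` M"] fin by blast
  have "\<exists>g. inj_on g (B - snd ` M) \<and> (\<forall>v\<in>B - snd ` M. g v \<in> {u. E u v} - snd ` prod.swap ` M)"
  proof (rule dual.residual_choice)
    show "matching (\<lambda>v u. E u v) (prod.swap ` M')"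
      by (rule matching_converse[OF M'(1)])
    show "prod.swap ` M \<subseteq> {..<c} \<times> {..<c}"
      using M by auto
  qed (use M'(2) cover(2) fin in \<open>auto simp: swap dual.radius_def radius_def\<close>)
  then obtain g where g: "inj_on g (B - snd ` M)"
    "\<And>v. v \<in> B - snd ` M \<Longrightarrow> g v \<in> {u. E u v} - fst ` M"
    unfolding swap by blast
  have "\<exists>M1\<subseteq>(\<lambda>u. (u, f u)) ` (A - fst ` M) \<union> (\<lambda>v. (g v, v)) ` (B - snd ` M).
      matching E M1 \<and> A - fst ` M \<subseteq> fst ` M1 \<and> B - snd ` M \<subseteq> snd ` M1"
    by (rule mendelsohn_dulmage) (use f g in auto)
  then obtain M1 where M1: "M1 \<subseteq> (\<lambda>u. (u, f u)) ` (A - fst ` M) \<union> (\<lambda>v. (g v, v)) ` (B - snd ` M)"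
    "matching E M1" "A - fst ` M \<subseteq> fst ` M1" "B - snd ` M \<subseteq> snd ` M1"
    by (elim exE conjE) (rule that)
  show "\<exists>M'. matching E M' \<and> finite M' \<and> M \<subseteq> M' \<and> A \<subseteq> fst ` M' \<and> B \<subseteq> snd ` M'"
  proof (intro exI conjI)
    have "fst x \<notin> fst ` M \<and> snd x \<notin> snd ` M" if "x \<in> M1" for x
    proof -
      consider u where "u \<in> A - fst ` M" "x = (u, f u)" | v where "v \<in> B - snd ` M" "x = (g v, v)"
        using M1(1) \<open>x \<in> M1\<close> by blast
      then show ?thesis
        using f(2) g(2) by cases simp_all
    qed
    then have "fst ` M \<inter> fst ` M1 = {}" "snd ` M \<inter> snd ` M1 = {}"
      unfolding disjoint_iff by (metis imageE)+
    then show "matching E (M \<union> M1)"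
      using matching_subset[OF M'] M1(2) by (intro matching_Un) blast+
    show "finite (M \<union> M1)"
      using finite_subset[OF M] finite_subset[OF M1(1)] fin by auto
  qed (use M1(3,4) in auto)
qed

text \<open>For \<open>c = 0\<close> the radius is \<open>\<beta> 0 = 0\<close>, so nothing has to
  be covered.\<close>

lemma extendable_empty: "extendable {}"
  by (rule extendable_if_covered[of "{}" _ 0]) (auto simp: matching_def radius_def bound_0)

text \<open>
  Only finitely many sets of edges incident with \<open>s\<close> can be added to \<open>M\<close>. If each of them had a
  finite obstruction, then the union of the obstructions would be one for \<open>M\<close>.
\<close>

lemma extendable_step:
  assumes "finite M" and M: "extendable M"
  shows "\<exists>M'. finite M' \<and> M \<subseteq> M' \<and> s \<in> fst ` M' \<and> s \<in> snd ` M' \<and> extendable M'"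
proof (rule ccontr)
  assume *: "\<not> ?thesis"
  \<comment> \<open>All edges at \<open>s\<close>, taken both as a left and as a right
    vertex.\<close>
  define P where "P = {s} \<times> {v. E s v} \<union> {u. E u s} \<times> {s}"
  define \<C> where "\<C> = {C \<in> Pow (M \<union> P). M \<subseteq> C \<and> s \<in> fst ` C \<and> s \<in> snd ` C}"
  have "finite P"
    unfolding P_def using finite_left finite_right by auto
  then have fin: "finite \<C>"
    unfolding \<C>_def using assms(1) by auto
  define extends where "extends A B C \<longleftrightarrow>
    (\<exists>M'. matching E M' \<and> finite M' \<and> C \<subseteq> M' \<and> A \<subseteq> fst ` M' \<and> B \<subseteq> snd ` M')" for A B C
  have extendable_iff: "extendable C \<longleftrightarrow> (\<forall>A B. finite A \<longrightarrow> finite B \<longrightarrow> extends A B C)" for C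
    by (simp add: extendable_def extends_def)
  have "\<not> extendable C" if "C \<in> \<C>" for C
    using that * assms(1) \<open>finite P\<close> unfolding \<C>_def by (blast intro: finite_subset)
  then obtain A B where AB: "\<And>C. C \<in> \<C> \<Longrightarrow> finite (A C)" "\<And>C. C \<in> \<C> \<Longrightarrow> finite (B C)"
    "\<And>C. C \<in> \<C> \<Longrightarrow> \<not> extends (A C) (B C) C"
    unfolding extendable_iff by metis
  have "finite (insert s (\<Union>(A ` \<C>)))" "finite (insert s (\<Union>(B ` \<C>)))"
    using fin AB(1,2) by auto
  with M obtain M' where M': "matching E M'" "finite M'" "M \<subseteq> M'"
    "insert s (\<Union>(A ` \<C>)) \<subseteq> fst ` M'" "insert s (\<Union>(B ` \<C>)) \<subseteq> snd ` M'"
    unfolding extendable_iff extends_def by meson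
  \<comment> \<open>The trace of \<open>M'\<close> on the candidate edges is itself one of the sets
    in \<open>\<C>\<close>, yet \<open>M'\<close> overcomes its obstruction.\<close>
  define C where "C = M' \<inter> (M \<union> P)"
  have "s \<in> fst ` M'" "s \<in> snd ` M'"
    using M'(4,5) by auto
  then obtain u v where "(s, v) \<in> M'" "(u, s) \<in> M'"
    by auto
  then have "(s, v) \<in> C" "(u, s) \<in> C"
    using matching_edge[OF M'(1)] by (auto simp: C_def P_def)
  then have "s \<in> fst ` C" "s \<in> snd ` C"
    by force+
  then have "C \<in> \<C>"
    using M'(3) by (auto simp: C_def \<C>_def)
  moreover have "A C \<subseteq> fst ` M'" "B C \<subseteq> snd ` M'"
    using M'(4,5) \<open>C \<in> \<C>\<close> by auto
  ultimately show False
    using AB(3)[of C] M'(1,2) unfolding extends_def C_def by blast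
qed

end

section \<open>Finite edge sets coded by natural numbers\<close>

definition edges :: "nat \<Rightarrow> (nat \<times> nat) set" where
  "edges c = prod_decode ` set_decode c"

lemma edges_iff: "(u, v) \<in> edges c \<longleftrightarrow> prod_encode (u, v) \<in> set_decode c"
  unfolding edges_def by (metis image_iff prod_decode_inverse prod_encode_inverse)

lemma finite_edges: "finite (edges c)"
  by (simp add: edges_def)

lemma edges_0: "edges 0 = {}"
  by (simp add: edges_def)

lemma edges_surj: "finite M \<Longrightarrow> \<exists>c. edges c = M"
  by (rule exI[of _ "set_encode (prod_encode ` M)"]) (simp add: edges_def image_image set_encode_inverse)

text \<open>A set bit \<open>p\<close> gives \<open>2 ^ p \<le> c\<close>. Hence quantifiers over a
  coded set are bounded by its code and stay decidable.\<close>

lemma less_if_in_set_decode: "p < c" if "p \<in> set_decode c"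
proof -
  have "c div 2 ^ p \<noteq> 0"
    using that unfolding set_decode_def by (auto intro: ccontr)
  then have "2 ^ p \<le> c"
    by (metis div_less not_le_imp_less)
  then show ?thesis
    using less_exp[of p] by linarith
qed

text \<open>A code bounds all vertices it mentions, so it can itself serve as \<open>c\<close> in
  \<open>extendable_if_covered\<close>.\<close>

lemma edges_bounded: "edges c \<subseteq> {..<c} \<times> {..<c}"
proof (rule subrelI)
  fix u v assume "(u, v) \<in> edges c"
  then have "prod_encode (u, v) < c"
    by (simp add: edges_iff less_if_in_set_decode)
  then show "(u, v) \<in> {..<c} \<times> {..<c}"
    using le_prod_encode_1[of u v] le_prod_encode_2[of v u] by simp
qed

lemma Ball_edges_iff:
  "(\<forall>x\<in>edges c. P x) \<longleftrightarrow> (\<forall>p<c. p \<in> set_decode c \<longrightarrow> P (prod_decode p))"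
  using less_if_in_set_decode by (auto simp: edges_def)

lemma Bex_edges_iff:
  "(\<exists>x\<in>edges c. P x) \<longleftrightarrow> (\<exists>p<c. p \<in> set_decode c \<and> P (prod_decode p))"
  using less_if_in_set_decode by (auto simp: edges_def)

lemma decidable_edges_subset:
  assumes "computable_fun f" and "computable_fun g"
  shows "decidable (\<lambda>x. edges (f x) \<subseteq> edges (g x))"
proof -
  have "edges c \<subseteq> edges d \<longleftrightarrow> (\<forall>p<c. p \<in> set_decode c \<longrightarrow> p \<in> set_decode d)" for c d
    unfolding edges_def inj_image_subset_iff[OF inj_prod_decode] using less_if_in_set_decode by blast
  then show ?thesis
    by (simp only:) (intro computable_intros assms computable_fun_comp[OF assms(1)]
        computable_fun_comp[OF assms(2)])
qed

lemma decidable_in_fst_edges: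
  assumes "computable_fun f" and "computable_fun g"
  shows "decidable (\<lambda>x. f x \<in> fst ` edges (g x))"
proof -
  have "f x \<in> fst ` edges (g x) \<longleftrightarrow>
      (\<exists>p<g x. p \<in> set_decode (g x) \<and> f x = fst (prod_decode p))" for x
    by (simp only: image_iff Bex_edges_iff)
  then show ?thesis
    by (simp only:) (intro computable_intros assms computable_fun_comp[OF assms(1)]
        computable_fun_comp[OF assms(2)])
qed

lemma decidable_in_snd_edges:
  assumes "computable_fun f" and "computable_fun g"
  shows "decidable (\<lambda>x. f x \<in> snd ` edges (g x))"
proof -
  have "f x \<in> snd ` edges (g x) \<longleftrightarrow>
      (\<exists>p<g x. p \<in> set_decode (g x) \<and> f x = snd (prod_decode p))" for x
    by (simp only: image_iff Bex_edges_iff)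
  then show ?thesis
    by (simp only:) (intro computable_intros assms computable_fun_comp[OF assms(1)]
        computable_fun_comp[OF assms(2)])
qed

lemma decidable_matching:
  assumes E: "decidable (\<lambda>z. E (fst (prod_decode z)) (snd (prod_decode z)))"
    and f: "computable_fun f"
  shows "decidable (\<lambda>x. matching E (edges (f x)))"
proof -
  \<comment> \<open>Both variables range over \<open>M\<close>, so the edge condition may stand
    below both quantifiers; for a coded \<open>M\<close> this is a bounded formula.\<close>
  have "matching E M \<longleftrightarrow> (\<forall>x\<in>M. \<forall>y\<in>M. E (fst x) (snd x) \<and>
      (fst x = fst y \<longrightarrow> snd x = snd y) \<and> (snd x = snd y \<longrightarrow> fst x = fst y))" for M
    unfolding matching_def inj_on_def by fastforce
  then show ?thesis
    by (simp only: Ball_edges_iff) (intro computable_intros assms computable_fun_comp[OF f] decidable_comp[OF E])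
qed

lemma decidable_lessThan_subset:
  assumes "computable_fun f" and "decidable (\<lambda>z. fst (prod_decode z) \<in> S (snd (prod_decode z)))"
  shows "decidable (\<lambda>x. {..<f x} \<subseteq> S x)"
  using decidable_All[OF assms] by (simp add: subset_iff)

section \<open>The computable stages of the matching\<close>

locale computable_expanding_graph = expanding_graph +
  assumes decidable_edge: "decidable (\<lambda>z. E (fst (prod_decode z)) (snd (prod_decode z)))"
    and computable_bound: "computable_fun \<beta>"
begin

text \<open>
  \<open>e\<close> codes a pair: an extension of the matching \<open>edges c\<close> that covers the vertices named \<open>s\<close> on both
  sides, and a larger matching which by \<open>extendable_if_covered\<close> shows that this extension is extendable.
\<close>

definition certificate :: "nat \<Rightarrow> nat \<Rightarrow> nat \<Rightarrow> bool" where
  "certificate s c e \<longleftrightarrow> (case prod_decode e of (c', d) \<Rightarrow>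
    edges c \<subseteq> edges c' \<and> s \<in> fst ` edges c' \<and> s \<in> snd ` edges c' \<and>
    edges c' \<subseteq> edges d \<and> matching E (edges d) \<and>
    {..<radius c'} \<subseteq> fst ` edges d \<and> {..<radius c'} \<subseteq> snd ` edges d)"

text \<open>This makes the search end: \<open>extendable_step\<close> supplies the enlarged
  matching, whose extendability is then applied to the ball of radius \<open>radius c'\<close> on
  both sides.\<close>

lemma certificate_exists:
  assumes "extendable (edges c)"
  shows "\<exists>e. certificate s c e"
proof -
  obtain c' where c': "edges c \<subseteq> edges c'" "s \<in> fst ` edges c'" "s \<in> snd ` edges c'"
    "extendable (edges c')"
    using extendable_step[OF finite_edges assms, of s] edges_surj by metis
  then obtain d where "edges c' \<subseteq> edges d" "matching E (edges d)"
    "{..<radius c'} \<subseteq> fst ` edges d" "{..<radius c'} \<subseteq> snd ` edges d"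
    unfolding extendable_def using edges_surj by (metis finite_lessThan)
  with c' show ?thesis
    by (intro exI[of _ "prod_encode (c', d)"]) (simp add: certificate_def)
qed

lemma computable_radius: "computable_fun f \<Longrightarrow> computable_fun (\<lambda>x. radius (f x))"
  unfolding radius_def by (intro computable_intros computable_bound)

lemma decidable_certificate:
  assumes "computable_fun f" and "computable_fun g" and "computable_fun h"
  shows "decidable (\<lambda>x. certificate (f x) (g x) (h x))"
  unfolding certificate_def case_prod_beta
  by (intro computable_intros decidable_edges_subset decidable_in_fst_edges decidable_in_snd_edges
      decidable_matching decidable_lessThan_subset decidable_edge computable_radius assms
      computable_fun_comp[OF assms(3)])

text \<open>Code 0 is the empty matching; of each certificate only the first component, the enlarged
  matching, is kept.\<close>

primrec stage :: "nat \<Rightarrow> nat" where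
  "stage 0 = 0"
| "stage (Suc s) = fst (prod_decode (LEAST e. certificate s (stage s) e))"

lemma stage_Suc:
  assumes "extendable (edges (stage s))"
  shows "edges (stage s) \<subseteq> edges (stage (Suc s))" "s \<in> fst ` edges (stage (Suc s))"
    "s \<in> snd ` edges (stage (Suc s))" "extendable (edges (stage (Suc s)))"
proof -
  define e where "e = (LEAST e. certificate s (stage s) e)"
  obtain d where d: "prod_decode e = (stage (Suc s), d)"
    by (cases "prod_decode e") (simp add: e_def)
  have "certificate s (stage s) e"
    unfolding e_def using certificate_exists[OF assms] by (rule LeastI_ex)
  then have e: "edges (stage s) \<subseteq> edges (stage (Suc s))" "s \<in> fst ` edges (stage (Suc s))"
    "s \<in> snd ` edges (stage (Suc s))"
    "edges (stage (Suc s)) \<subseteq> edges d" "matching E (edges d)"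
    "{..<radius (stage (Suc s))} \<subseteq> fst ` edges d" "{..<radius (stage (Suc s))} \<subseteq> snd ` edges d"
    unfolding certificate_def d prod.case by blast+
  show "edges (stage s) \<subseteq> edges (stage (Suc s))" "s \<in> fst ` edges (stage (Suc s))"
    "s \<in> snd ` edges (stage (Suc s))"
    by (rule e)+
  show "extendable (edges (stage (Suc s)))"
    by (rule extendable_if_covered[OF e(5,4) edges_bounded e(6,7)])
qed

lemma extendable_stage: "extendable (edges (stage s))"
  by (induction s) (use extendable_empty stage_Suc in \<open>auto simp: edges_0\<close>)

lemma stage_mono: "s \<le> t \<Longrightarrow> edges (stage s) \<subseteq> edges (stage t)"
  by (rule lift_Suc_mono_le[of "\<lambda>s. edges (stage s)"]) (rule stage_Suc(1)[OF extendable_stage])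

lemma computable_stage: "computable_fun stage"
proof (rule computable_iterated_Least)
  show "decidable (\<lambda>z. certificate (fst (prod_decode z)) (fst (prod_decode (snd (prod_decode z))))
      (snd (prod_decode (snd (prod_decode z)))))"
    by (intro decidable_certificate computable_intros)
  show "computable_fun (\<lambda>e. fst (prod_decode e))"
    by (rule computable_unpair)
  show "\<exists>e. certificate n (stage n) e" for n
    by (rule certificate_exists[OF extendable_stage])
qed simp_all

text \<open>The vertices \<open>u\<close> of both sides have partners from stage
  \<open>Suc u\<close> on and keep them, since later stages are matchings containing the earlier
  ones. So \<open>f u\<close> can be read off there, and covering right vertices makes
  \<open>f\<close> surjective.\<close>

lemma perfect_matching:
  "\<exists>f. computable_fun f \<and> bij f \<and> (\<forall>u. E u (f u))"
proof -
  define f where "f u = (LEAST v. prod_encode (u, v) \<in> set_decode (stage (Suc u)))" for u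
  have ex: "\<exists>v. prod_encode (u, v) \<in> set_decode (stage (Suc u))" for u
    using stage_Suc(2)[OF extendable_stage, of u] unfolding edges_iff[symmetric] by force
  have f: "(u, f u) \<in> edges (stage (Suc u))" for u
    unfolding f_def edges_iff using ex by (rule LeastI_ex)
  have matching: "matching E (edges (stage s))" for s
    by (rule extendable_imp_matching[OF extendable_stage])
  have f_eq: "f u = v" if "(u, v) \<in> edges (stage s)" for u v s
    using f[of u] that stage_mono[of s "max s (Suc u)"] stage_mono[of "Suc u" "max s (Suc u)"]
      matching_right_unique[OF matching[of "max s (Suc u)"], of u] by auto
  show ?thesis
  proof (intro exI conjI allI)
    show "computable_fun f"
      unfolding f_def
      by (rule computable_Least, intro computable_intros computable_fun_comp[OF computable_stage]) (rule ex)
    show "bij f"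
    proof (rule bijI)
      show "inj f"
      proof (rule injI)
        fix u u' assume "f u = f u'"
        with f[of u] f[of u'] show "u = u'"
          using stage_mono[of "Suc u" "max (Suc u) (Suc u')"] stage_mono[of "Suc u'" "max (Suc u) (Suc u')"]
            matching_left_unique[OF matching[of "max (Suc u) (Suc u')"], of u "f u" u'] by auto
      qed
      show "surj f"
        unfolding surj_def
      proof
        fix v
        obtain u where "(u, v) \<in> edges (stage (Suc v))"
          using stage_Suc(3)[OF extendable_stage, of v] by force
        then show "\<exists>u. v = f u"
          using f_eq by blast
      qed
    qed
    show "E u (f u)" for u
      by (rule matching_edge[OF matching f])
  qed
qed

end

section \<open>Paradoxical decompositions\<close>

text \<open>Where several \<open>k\<close> agree with \<open>h\<close> at a point, the one with the
  least index under \<open>i\<close> is taken. So the sets \<open>A k\<close> partition the space,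
  and finitely many comparisons of computable values decide them.\<close>

lemma computable_selection:
  fixes K :: "(nat \<Rightarrow> nat) set"
  assumes K: "finite K" "\<And>k. k \<in> K \<Longrightarrow> computable_fun k"
    and h: "computable_fun h" "\<And>x. \<exists>k\<in>K. h x = k x"
  shows "\<exists>A. (\<forall>k\<in>K. computable_set (A k)) \<and> disjoint_family_on A K \<and> (\<Union>k\<in>K. A k) = UNIV \<and>
    (\<forall>k\<in>K. k ` A k = h ` A k)"
proof -
  obtain i :: "(nat \<Rightarrow> nat) \<Rightarrow> nat" where i: "inj_on i K"
    using finite_imp_inj_to_nat_seg[OF K(1)] by blast
  define A where "A k = {x. h x = k x \<and> \<not> (\<exists>k'\<in>{k' \<in> K. i k' < i k}. h x = k' x)}" for k
  show ?thesis
  proof (intro exI conjI ballI)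
    fix k assume k: "k \<in> K"
    have "decidable (\<lambda>x. h x = k x \<and> \<not> (\<exists>k'\<in>{k' \<in> K. i k' < i k}. h x = k' x))"
      using K k h(1) by (intro decidable_conj decidable_not decidable_finite_Bex decidable_eq) auto
    then show "computable_set (A k)"
      unfolding decidable_def A_def .
    show "k ` A k = h ` A k"
      unfolding A_def by (rule image_cong) auto
  next
    show "disjoint_family_on A K"
      unfolding disjoint_family_on_def A_def using i
      by (auto simp: inj_on_def) (metis linorder_neqE_nat)
    show "(\<Union>k\<in>K. A k) = UNIV"
    proof -
      have "\<exists>k\<in>K. x \<in> A k" for x
      proof -
        obtain k where "k \<in> K" "h x = k x" "\<And>k'. k' \<in> K \<and> h x = k' x \<Longrightarrow> i k \<le> i k'"
          using ex_has_least_nat[of "\<lambda>k. k \<in> K \<and> h x = k x" _ i] h(2)[of x] by blast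
        then show ?thesis
          unfolding A_def by (auto simp: not_less[symmetric])
      qed
      then show ?thesis
        by blast
    qed
  qed
qed

text \<open>If \<open>r\<close> maps a boundary point \<open>x\<close> into \<open>F\<close>, then
  \<open>x\<close> lies in the image of \<open>F\<close> under the inverse of \<open>r\<close>;
  \<open>id\<close> contributes \<open>F\<close> itself.\<close>

lemma card_boundary_le:
  fixes R :: "('a \<Rightarrow> 'a) set"
  assumes "finite R" and "\<And>r. r \<in> R \<Longrightarrow> bij r" and "finite F"
  shows "card F + card (boundary R F) \<le> card (\<Union>k\<in>insert id (R \<union> inv_into UNIV ` R). k ` F)"
proof -
  let ?S = "insert id (R \<union> inv_into UNIV ` R)"
  have fin: "finite (\<Union>k\<in>?S. k ` F)"
    using assms by auto
  have "x \<in> (\<Union>k\<in>?S. k ` F)" if x: "x \<in> boundary R F" for x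
  proof -
    obtain r where r: "r \<in> R \<union> inv_into UNIV ` R" "r x \<in> F"
      using x unfolding boundary_def by blast
    then have "bij r"
      using assms(2) by (auto intro: bij_imp_bij_inv)
    moreover have "inv_into UNIV r \<in> ?S"
      using r(1) assms(2) by (auto simp: inv_inv_eq)
    ultimately show ?thesis
      using r(2) by (metis UN_I bij_inv_eq_iff image_eqI)
  qed
  then have "boundary R F \<subseteq> (\<Union>k\<in>?S. k ` F)"
    by (rule subsetI)
  then have sub: "F \<union> boundary R F \<subseteq> (\<Union>k\<in>?S. k ` F)"
    by simp
  have "card F + card (boundary R F) = card (F \<union> boundary R F)"
    using finite_subset[OF sub fin] by (subst card_Un_disjoint) (auto simp: boundary_def)
  also have "\<dots> \<le> card (\<Union>k\<in>?S. k ` F)"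
    by (rule card_mono[OF fin sub])
  finally show ?thesis .
qed

text \<open>Failure of Folner's condition gives a set expanding by \<open>1 + 1 / n\<close>.
  Replacing \<open>K\<close> by all products of two of its elements squares the factor and preserves
  closure under inverses, so repetition reaches any \<open>D\<close>.\<close>

lemma ex_expanding_subset:
  fixes G :: "('a \<Rightarrow> 'a) set" and D :: nat
  assumes G: "subgroup G (BijGroup UNIV)" and "\<not> folner_condition G"
  shows "\<exists>K\<subseteq>G. finite K \<and> (\<forall>k\<in>K. inv_into UNIV k \<in> K) \<and>
    (\<forall>F. finite F \<longrightarrow> D * card F \<le> card (\<Union>k\<in>K. k ` F))"
proof -
  have bij: "\<And>g. g \<in> G \<Longrightarrow> bij g" and id: "id \<in> G"
    and comp: "\<And>g h. g \<in> G \<Longrightarrow> h \<in> G \<Longrightarrow> g \<circ> h \<in> G" and inv: "\<And>g. g \<in> G \<Longrightarrow> inv_into UNIV g \<in> G"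
    using G unfolding subgroup_BijGroup_UNIV_iff by blast+
  obtain R n where R: "R \<subseteq> G" "finite R" "n \<ge> 1"
    and large: "\<And>F. finite F \<Longrightarrow> F \<noteq> {} \<Longrightarrow> 1 / real n * real (card F) \<le> real (card (boundary R F))"
    using assms(2) unfolding folner_condition_def by (meson not_less)
  define q where "q = 1 + 1 / real n"
  have "1 < q"
    using R(3) by (simp add: q_def)
  have "\<exists>K\<subseteq>G. finite K \<and> (\<forall>k\<in>K. inv_into UNIV k \<in> K) \<and>
    (\<forall>F. finite F \<longrightarrow> q ^ (2 ^ i) * real (card F) \<le> real (card (\<Union>k\<in>K. k ` F)))" for i :: nat
  proof (induction i)
    case 0
    show ?case
    proof (intro exI conjI allI impI)
      let ?S = "insert id (R \<union> inv_into UNIV ` R)"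
      show "?S \<subseteq> G" "finite ?S"
        using R id inv by auto
      have "inv_into UNIV (inv_into UNIV r) = r" if "r \<in> R" for r
        using that R(1) bij inv_inv_eq by blast
      then show "\<forall>k\<in>?S. inv_into UNIV k \<in> ?S"
        by auto
      fix F :: "'a set" assume F: "finite F"
      have "q * real (card F) \<le> real (card F) + real (card (boundary R F))"
        using large[OF F] by (cases "F = {}") (auto simp: q_def algebra_simps)
      also have "\<dots> \<le> real (card (\<Union>k\<in>?S. k ` F))"
        using card_boundary_le[OF R(2) _ F] bij R(1) by (metis of_nat_add of_nat_mono subsetD)
      finally show "q ^ 2 ^ 0 * real (card F) \<le> real (card (\<Union>k\<in>?S. k ` F))"
        by simp
    qed
  next
    case (Suc i)
    then obtain K where K: "K \<subseteq> G" "finite K" "\<And>k. k \<in> K \<Longrightarrow> inv_into UNIV k \<in> K"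
      and growth: "\<And>F. finite F \<Longrightarrow> q ^ (2 ^ i) * real (card F) \<le> real (card (\<Union>k\<in>K. k ` F))"
      by blast
    show ?case
    proof (intro exI conjI allI impI ballI)
      let ?K = "(\<lambda>p. fst p \<circ> snd p) ` (K \<times> K)"
      show "?K \<subseteq> G" "finite ?K"
        using K(1,2) by (auto intro!: comp)
      show "inv_into UNIV k \<in> ?K" if "k \<in> ?K" for k
      proof -
        from that obtain p where p: "k = fst p \<circ> snd p" "p \<in> K \<times> K"
          by (rule imageE)
        then have "fst p \<in> K" "snd p \<in> K"
          by auto
        then have "inv_into UNIV k = inv_into UNIV (snd p) \<circ> inv_into UNIV (fst p)"
          unfolding p(1) using bij K(1) by (intro o_inv_distrib) blast+
        with K(3) \<open>fst p \<in> K\<close> \<open>snd p \<in> K\<close> show ?thesis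
          by (intro image_eqI[of _ _ "(inv_into UNIV (snd p), inv_into UNIV (fst p))"]) auto
      qed
      have UN_pairs: "(\<Union>a\<in>K. \<Union>b\<in>K. h a b) = (\<Union>p\<in>K \<times> K. h (fst p) (snd p))"
        for h :: "('a \<Rightarrow> 'a) \<Rightarrow> ('a \<Rightarrow> 'a) \<Rightarrow> 'a set"
        by fastforce
      fix F :: "'a set" assume F: "finite F"
      have "q ^ (2 ^ Suc i) * real (card F) = q ^ (2 ^ i) * (q ^ (2 ^ i) * real (card F))"
        by (simp add: power_add[symmetric] mult_2)
      also have "\<dots> \<le> q ^ (2 ^ i) * real (card (\<Union>k\<in>K. k ` F))"
        using growth[OF F] \<open>1 < q\<close> by (intro mult_left_mono) auto
      also have "\<dots> \<le> real (card (\<Union>a\<in>K. a ` (\<Union>b\<in>K. b ` F)))"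
        using F K(2) by (intro growth) auto
      also have "(\<Union>a\<in>K. a ` (\<Union>b\<in>K. b ` F)) = (\<Union>k\<in>?K. k ` F)"
        using UN_pairs[of "\<lambda>a b. (a \<circ> b) ` F"] by (simp add: image_UN image_comp)
      finally show "q ^ (2 ^ Suc i) * real (card F) \<le> real (card (\<Union>k\<in>?K. k ` F))" .
    qed
  qed
  \<comment> \<open>This \<open>i\<close> also serves as the number of squarings, as
    \<open>i \<le> 2 ^ i\<close>.\<close>
  moreover obtain i where "real D < q ^ i"
    using real_arch_pow[OF \<open>1 < q\<close>] by blast
  ultimately obtain K where K: "K \<subseteq> G" "finite K" "\<forall>k\<in>K. inv_into UNIV k \<in> K"
    and growth: "\<And>F. finite F \<Longrightarrow> q ^ (2 ^ i) * real (card F) \<le> real (card (\<Union>k\<in>K. k ` F))"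
    by metis
  have "real D \<le> q ^ (2 ^ i)"
    using \<open>real D < q ^ i\<close> power_increasing[of i "2 ^ i" q] \<open>1 < q\<close> less_exp[of i] by linarith
  have "D * card F \<le> card (\<Union>k\<in>K. k ` F)" if "finite F" for F
  proof -
    have "real (D * card F) \<le> q ^ (2 ^ i) * real (card F)"
      using \<open>real D \<le> q ^ (2 ^ i)\<close> by (simp add: mult_right_mono)
    also note growth[OF that]
    finally show ?thesis
      by linarith
  qed
  with K show ?thesis
    by blast
qed

lemma card_le_double_image_div2: "card F \<le> 2 * card ((\<lambda>u. u div 2) ` F)" if "finite F" for F :: "nat set"
proof -
  let ?D = "(\<lambda>u. u div 2) ` F"
  have "F \<subseteq> (\<lambda>x. 2 * x) ` ?D \<union> (\<lambda>x. Suc (2 * x)) ` ?D"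
  proof
    fix u assume "u \<in> F"
    then show "u \<in> (\<lambda>x. 2 * x) ` ?D \<union> (\<lambda>x. Suc (2 * x)) ` ?D"
      by (cases "even u") (auto simp: image_iff elim!: evenE oddE intro!: bexI[of _ u])
  qed
  then have "card F \<le> card ((\<lambda>x. 2 * x) ` ?D \<union> (\<lambda>x. Suc (2 * x)) ` ?D)"
    using that by (intro card_mono) auto
  also have "\<dots> \<le> card ((\<lambda>x. 2 * x) ` ?D) + card ((\<lambda>x. Suc (2 * x)) ` ?D)"
    by (rule card_Un_le)
  also have "\<dots> \<le> 2 * card ?D"
    using card_image_le[of ?D "\<lambda>x. 2 * x"] card_image_le[of ?D "\<lambda>x. Suc (2 * x)"] that by simp
  finally show ?thesis .
qed

text \<open>
  The vertices \<open>2 * x\<close> and \<open>2 * x + 1\<close> are two copies of \<open>x\<close>, so that a perfect matching assigns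
  two points to each \<open>x\<close>.
\<close>

lemma ex_doubling_bijection:
  fixes K :: "(nat \<Rightarrow> nat) set"
  assumes K: "finite K" "\<And>k. k \<in> K \<Longrightarrow> computable_fun k" "\<And>k. k \<in> K \<Longrightarrow> bij k"
    "\<And>k. k \<in> K \<Longrightarrow> inv_into UNIV k \<in> K"
    and growth: "\<And>F. finite F \<Longrightarrow> 4 * card F \<le> card (\<Union>k\<in>K. k ` F)"
  shows "\<exists>f. computable_fun f \<and> bij f \<and> (\<forall>u. \<exists>k\<in>K. f u = k (u div 2))"
proof -
  define E where "E u v \<longleftrightarrow> (\<exists>k\<in>K. v = k (u div 2))" for u v
  \<comment> \<open>Taking the least bound makes \<open>\<beta>\<close> computable by search and
    gives \<open>\<beta> 0 = 0\<close>. \<open>Suc (2 * k x)\<close> is the larger copy of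
    \<open>k x\<close>, so one bound serves both sides.\<close>
  define \<beta> where "\<beta> n = (LEAST m. n \<le> m \<and> (\<forall>x<n. \<forall>k\<in>K. Suc (2 * k x) < m))" for n
  have ex: "\<exists>m. n \<le> m \<and> (\<forall>x<n. \<forall>k\<in>K. Suc (2 * k x) < m)" for n
  proof -
    have "finite (insert n ((\<lambda>(x, k). Suc (2 * k x)) ` ({..<n} \<times> K)))"
      using K(1) by simp
    from finite_nat_set_iff_bounded[THEN iffD1, OF this] show ?thesis
      by (auto intro: less_imp_le)
  qed
  have \<beta>: "n \<le> \<beta> n \<and> (\<forall>x<n. \<forall>k\<in>K. Suc (2 * k x) < \<beta> n)" for n
    unfolding \<beta>_def using ex by (rule LeastI_ex)
  \<comment> \<open>By closure under inverses, the neighbours of a right vertex are also described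
    by \<open>K\<close>.\<close>
  have E_iff: "E u v \<longleftrightarrow> (\<exists>k\<in>K. u div 2 = k v)" for u v
    using K(3,4) unfolding E_def by (metis bij_inv_eq_iff)
  interpret computable_expanding_graph E \<beta>
  proof
    show "\<beta> 0 = 0"
      unfolding \<beta>_def by (rule Least_equality) auto
    show "n \<le> \<beta> n" for n
      using \<beta> by blast
    show "v < \<beta> n" if "E u v" "u < n" for u v n
    proof -
      from that(1)[unfolded E_def] obtain k where "k \<in> K" "v = k (u div 2)"
        by (rule bexE)
      moreover have "u div 2 < n"
        using that(2) by linarith
      ultimately have "Suc (2 * v) < \<beta> n"
        using \<beta> by blast
      then show ?thesis
        by linarith
    qed
    show "u < \<beta> n" if "E u v" "v < n" for u v n
    proof -
      from that(1)[unfolded E_iff] obtain k where "k \<in> K" "u div 2 = k v"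
        by (rule bexE)
      then have "Suc (2 * (u div 2)) < \<beta> n"
        using \<beta> that(2) by metis
      then show ?thesis
        by linarith
    qed
    show "2 * card F \<le> card {v. \<exists>u\<in>F. E u v}" if "finite F" for F
    proof -
      \<comment> \<open>Merging the two copies loses a factor 2 of the growth factor 4.\<close>
      have "{v. \<exists>u\<in>F. E u v} = (\<Union>k\<in>K. k ` (\<lambda>u. u div 2) ` F)"
        unfolding E_def by auto
      then show ?thesis
        using growth[of "(\<lambda>u. u div 2) ` F"] card_le_double_image_div2[OF that] that by simp
    qed
    show "2 * card F \<le> card {u. \<exists>v\<in>F. E u v}" if "finite F" for F
    proof -
      have eq: "{u. \<exists>v\<in>F. E u v} = {u. u div 2 \<in> (\<Union>k\<in>K. k ` F)}"
        unfolding E_iff by (simp only: UN_iff image_iff) blast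
      \<comment> \<open>The even copies alone give enough neighbours.\<close>
      have "(\<lambda>x. 2 * x) ` (\<Union>k\<in>K. k ` F) \<subseteq> {u. \<exists>v\<in>F. E u v}"
        unfolding eq by fastforce
      moreover have "{u. u div 2 \<in> (\<Union>k\<in>K. k ` F)} \<subseteq> (\<Union>m\<in>(\<Union>k\<in>K. k ` F). {..Suc (2 * m)})"
        by (rule subsetI, rule UN_I) auto
      then have "finite {u. \<exists>v\<in>F. E u v}"
        unfolding eq using that K(1) by (elim finite_subset) auto
      ultimately have "card ((\<lambda>x. 2 * x) ` (\<Union>k\<in>K. k ` F)) \<le> card {u. \<exists>v\<in>F. E u v}"
        by (intro card_mono)
      then show ?thesis
        using growth[OF that] by (simp add: card_image inj_on_def)
    qed
    have "computable_fun (\<lambda>z. k (fst (prod_decode z) div 2))" if "k \<in> K" for k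
      by (intro computable_fun_comp[OF K(2)[OF that]] computable_div computable_unpair computable_const) simp
    then show "decidable (\<lambda>z. E (fst (prod_decode z)) (snd (prod_decode z)))"
      unfolding E_def by (intro decidable_finite_Bex decidable_eq K(1) computable_unpair)
    show "computable_fun \<beta>"
      unfolding \<beta>_def
    proof (rule computable_Least)
      have "decidable (\<lambda>z. Suc (2 * k (fst (prod_decode z))) < fst (prod_decode (snd (prod_decode z))))"
        if "k \<in> K" for k
        by (intro computable_intros computable_fun_comp[OF K(2)[OF that]])
      then show "decidable (\<lambda>z. snd (prod_decode z) \<le> fst (prod_decode z) \<and>
          (\<forall>x<snd (prod_decode z). \<forall>k\<in>K. Suc (2 * k x) < fst (prod_decode z)))"
        by (intro decidable_conj decidable_le decidable_All decidable_finite_Ball computable_unpair K(1))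
    qed (rule ex)
  qed
  show ?thesis
    using perfect_matching unfolding E_def .
qed

theorem theorem1:
  fixes G :: "(nat \<Rightarrow> nat) set"
  assumes "subgroup G (BijGroup UNIV)"
    and "\<And>g. g \<in> G \<Longrightarrow> computable_fun g"
    and "\<not> folner_condition G"
  shows "\<exists>K A B. K \<subseteq> G \<and> computable_paradoxical_decomposition K A B"
proof -
  \<comment> \<open>The factor 4 is the expansion 2 of the graph times the two copies of each
    point.\<close>
  obtain K where K: "K \<subseteq> G" "finite K" "\<And>k. k \<in> K \<Longrightarrow> inv_into UNIV k \<in> K"
    and growth: "\<And>F. finite F \<Longrightarrow> 4 * card F \<le> card (\<Union>k\<in>K. k ` F)"
    using ex_expanding_subset[OF assms(1,3), of 4] by blast
  have comp: "\<And>k. k \<in> K \<Longrightarrow> computable_fun k" and bij: "\<And>k. k \<in> K \<Longrightarrow> bij k"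
    using K(1) assms(1,2) unfolding subgroup_BijGroup_UNIV_iff by blast+
  obtain f where f: "computable_fun f" "bij f" "\<And>u. \<exists>k\<in>K. f u = k (u div 2)"
    using ex_doubling_bijection[OF K(2) comp bij K(3) growth] by blast
  \<comment> \<open>The two copies of \<open>x\<close> go to \<open>f0 x\<close> and
    \<open>f1 x\<close>; since \<open>f\<close> is bijective, these injections have complementary
    ranges.\<close>
  define f0 where "f0 x = f (2 * x)" for x
  define f1 where "f1 x = f (Suc (2 * x))" for x
  have f_eq: "f u = f v \<longleftrightarrow> u = v" for u v
    using bij_is_inj[OF f(2)] by (rule inj_eq)
  have inj: "inj f0" "inj f1" and disj: "range f0 \<inter> range f1 = {}"
    unfolding f0_def f1_def by (auto simp: inj_def f_eq double_not_eq_Suc_double)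
  have cover: "range f0 \<union> range f1 = UNIV"
  proof -
    have "y \<in> range f0 \<union> range f1" for y
    proof -
      obtain u where "y = f u"
        using f(2) by (metis bij_pointE)
      then show ?thesis
        by (cases "even u") (auto simp: f0_def f1_def elim!: evenE oddE)
    qed
    then show ?thesis
      by blast
  qed
  have "computable_fun f0" "computable_fun f1"
    unfolding f0_def f1_def by (intro computable_fun_comp[OF f(1)] computable_intros)+
  moreover have "\<exists>k\<in>K. f0 x = k x" "\<exists>k\<in>K. f1 x = k x" for x
    using f(3)[of "2 * x"] f(3)[of "Suc (2 * x)"] by (simp_all add: f0_def f1_def)
  ultimately obtain A B where A: "\<forall>k\<in>K. computable_set (A k)" "disjoint_family_on A K"
      "(\<Union>k\<in>K. A k) = UNIV" "\<forall>k\<in>K. k ` A k = f0 ` A k"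
    and B: "\<forall>k\<in>K. computable_set (B k)" "disjoint_family_on B K"
      "(\<Union>k\<in>K. B k) = UNIV" "\<forall>k\<in>K. k ` B k = f1 ` B k"
    using computable_selection[OF K(2) comp, of f0] computable_selection[OF K(2) comp, of f1] by blast
  have disjoint: "disjoint_family_on (\<lambda>k. h ` C k) K"
    if "inj h" "disjoint_family_on C K" for h :: "nat \<Rightarrow> nat" and C
    using that by (simp add: disjoint_family_on_def image_Int[symmetric])
  \<comment> \<open>The pieces cover the space, so their images fill the whole range of
    \<open>f0\<close> or \<open>f1\<close>.\<close>
  have images: "(\<Union>k\<in>K. k ` A k) = range f0" "(\<Union>k\<in>K. k ` B k) = range f1"
    using A(3,4) B(3,4) by (simp_all add: image_UN[symmetric])
  have "disjoint_family_on (\<lambda>k. k ` A k) K" "disjoint_family_on (\<lambda>k. k ` B k) K"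
    using disjoint[OF inj(1) A(2)] disjoint[OF inj(2) B(2)] A(4) B(4)
    by (simp_all add: disjoint_family_on_def)
  then have "paradoxical_decomposition K A B"
    unfolding paradoxical_decomposition_def images using A(2,3) B(2,3) disj cover by simp
  then show ?thesis
    using K(1,2) A(1) B(1) unfolding computable_paradoxical_decomposition_def by blast
qed

end
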